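(* Let $T\subseteq\omega^{<\omega_1}$ be a normal, $\omega$-splitting $\ell_\infty$-tree. If $T$ is Souslin, then $[\omega_1]^{<\omega}\not\le_T G(\mathcal F^\infty_T)$, where $[\omega_1]^{<\omega}$ is directed by $\subseteq$.
   Context: $\omega^{<\omega_1}$ is the set of functions from countable ordinals to $\omega$. Consider $T\subseteq\omega^{<\omega_1}$ ordered by strict end-extension $\subsetneq$ and closed under restrictions to smaller ordinals, so $T$ is a tree in which the height of $t$ is $\mathrm{ht}(t)=\mathrm{dom}(t)$; $T_\alpha$ is the set of nodes of height $\alpha$ and $T\restriction\delta=\bigcup_{\gamma<\delta}T_\gamma$. $T$ is an $\omega_1$-tree if it has height $\omega_1$ and all levels are countable; it is normal if whenever $s\in T$ and $\mathrm{ht}(s)<\alpha<\omega_1$ there is $t\in T_\alpha$ with $s\subsetneq t$; it is $\omega$-splitting if every node has infinitely many immediate successors; an $\omega_1$-tree is Souslin if it has no uncountable chains and no uncountable antichains. For $f,g\in\omega^{<\omega_1}$ let $\|f\|_\infty=\sup\{f(\gamma):\gamma\in\mathrm{dom}(f)\}$, and let $f-g$ be the function with domain $\mathrm{dom}(f)\cap\mathrm{dom}(g)$ and $(f-g)(\gamma)=|f(\gamma)-g(\gamma)|$. An $\omega_1$-tree $T\subseteq\omega^{<\omega_1}$ is an $\ell_\infty$-tree if $\|s-t\|_\infty<\omega$ for all $s,t\in T$. For $t\in T$ and $n<\omega$ let $F^\infty_n(t)=\{s\in T\restriction\mathrm{ht}(t):\|s-t\|_\infty\le n\}$ and $U^\infty_n(t)=\{a\in[T]^{<\omega}:a\cap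 F^\infty_n(t)=\emptyset\}$. $G(\mathcal F^\infty_T)$ is the group $([T]^{<\omega},\triangle)$ of finite subsets of $T$ with symmetric difference, with the group topology for which $\{U^\infty_n(t):n<\omega,t\in T\}$ is an open neighborhood base at the identity $\emptyset$. Tukey order: for directed sets $D,E$, $D\le_T E$ means there is a map $f:D\to E$ such that $f[X]$ is unbounded in $E$ whenever $X$ is unbounded in $D$. For a topological group $G$, $D\le_T G$ means $D\le_T(\mathcal B_e,\supseteq)$, where $\mathcal B_e$ is the set of open neighborhoods of the identity, directed by reverse inclusion (smaller sets are larger in the order). *)

theory Defs
  imports
    "HOL-Analysis.Analysis"
    "HOL-Algebra.Coset"
    "HOL-Library.Extended_Nat"
    "HOL-Library.Countable_Set_Type"
begin

section \<open>The ordinal \<open>\<omega>\<^sub>1\<close>\<close>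

text \<open>
  The elements of this type are the countable ordinals: \<^term>\<open>cardSuc natLeq\<close> is a well-order
  of the least uncountable order type. The von Neumann ordinal \<open>\<alpha>\<close> corresponds
  to the set \<open>{..<\<alpha>}\<close>.
\<close>

typedef omega1 = "Field (cardSuc natLeq)"
  using Field_cardSuc_not_empty[OF natLeq_Card_order] by blast

instantiation omega1 :: linorder
begin

definition less_eq_omega1 :: "omega1 \<Rightarrow> omega1 \<Rightarrow> bool" where
  "x \<le> y \<longleftrightarrow> (Rep_omega1 x, Rep_omega1 y) \<in> cardSuc natLeq"

definition less_omega1 :: "omega1 \<Rightarrow> omega1 \<Rightarrow> bool" where
  "x < y \<longleftrightarrow> x \<le> y \<and> x \<noteq> y" for x y :: omega1

lemma Well_order_cardSuc_natLeq: "Well_order (cardSuc natLeq)"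
  by (rule cardSuc_Well_order[OF natLeq_Card_order])

instance
proof
  have L: "Linear_order (cardSuc natLeq)"
    using Well_order_cardSuc_natLeq by (simp add: well_order_on_def)
  have R: "\<And>x. x \<in> Field (cardSuc natLeq) \<Longrightarrow> (x, x) \<in> cardSuc natLeq"
    using L by (auto simp: order_on_defs refl_on_def)
  have T: "trans (cardSuc natLeq)" and A: "antisym (cardSuc natLeq)"
    and Tot: "total_on (Field (cardSuc natLeq)) (cardSuc natLeq)"
    using L by (auto simp: order_on_defs)
  fix x y z :: omega1
  show "x \<le> x"
    using R Rep_omega1 by (simp add: less_eq_omega1_def)
  show "x \<le> y \<Longrightarrow> y \<le> z \<Longrightarrow> x \<le> z"
    using T unfolding less_eq_omega1_def by (blast dest: transD)
  show as: "x \<le> y \<Longrightarrow> y \<le> x \<Longrightarrow> x = y" for x y :: omega1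
    using A unfolding less_eq_omega1_def by (auto dest: antisymD simp: Rep_omega1_inject)
  show "(x < y) = (x \<le> y \<and> \<not> y \<le> x)"
    using as R[OF Rep_omega1] by (auto simp: less_omega1_def less_eq_omega1_def)
  show "x \<le> y \<or> y \<le> x"
    using Tot R Rep_omega1[of x] Rep_omega1[of y]
    unfolding less_eq_omega1_def total_on_def by (cases "Rep_omega1 x = Rep_omega1 y") auto
qed

end

instance omega1 :: wellorder
proof
  fix P :: "omega1 \<Rightarrow> bool" and a
  assume step: "\<And>x. (\<And>y. y < x \<Longrightarrow> P y) \<Longrightarrow> P x"
  have "wf (cardSuc natLeq - Id)"
    using Well_order_cardSuc_natLeq by (simp add: well_order_on_def)
  then have "wf (inv_image (cardSuc natLeq - Id) Rep_omega1)"
    by (rule wf_inv_image)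
  moreover have "inv_image (cardSuc natLeq - Id) Rep_omega1 = {(x, y). x < y}"
    by (auto simp: less_omega1_def less_eq_omega1_def Rep_omega1_inject)
  ultimately have "wf {(x :: omega1, y). x < y}" by simp
  then show "P a"
    by (induction a rule: wf_induct_rule) (use step in auto)
qed

lemma countable_lessThan_omega1:
  includes cardinal_syntax
  shows "countable {..<a :: omega1}"
proof -
  let ?A = "underS (cardSuc natLeq) (Rep_omega1 a)"
  have "|?A| <o cardSuc natLeq"
    by (rule card_of_underS[OF cardSuc_Card_order[OF natLeq_Card_order] Rep_omega1])
  then have "|?A| \<le>o natLeq"
    using cardSuc_ordLeq_ordLess[OF natLeq_Card_order card_of_Card_order] by blast
  then have "countable ?A"
    by (simp add: countable_card_le_natLeq)
  moreover have "Rep_omega1 ` {..<a} \<subseteq> ?A"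
    by (auto simp: underS_def less_omega1_def less_eq_omega1_def Rep_omega1_inject)
  ultimately have "countable (Rep_omega1 ` {..<a})"
    by (rule countable_subset[rotated])
  then show ?thesis
    by (rule countable_image_inj_on) (simp add: inj_on_def Rep_omega1_inject)
qed

lemma uncountable_UNIV_omega1:
  includes cardinal_syntax
  shows "uncountable (UNIV :: omega1 set)"
proof
  assume "countable (UNIV :: omega1 set)"
  then have "countable (Rep_omega1 ` UNIV)" by simp
  then have "countable (Field (cardSuc natLeq))"
    by (metis type_definition.Rep_range type_definition_omega1)
  then have "|Field (cardSuc natLeq)| \<le>o natLeq"
    by (simp add: countable_card_le_natLeq)
  then have "cardSuc natLeq \<le>o natLeq"
    using card_of_Field_ordIso[OF cardSuc_Card_order[OF natLeq_Card_order]]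
      ordIso_ordLeq_trans ordIso_symmetric by blast
  then show False
    using cardSuc_greater[OF natLeq_Card_order] not_ordLess_ordLeq by blast
qed

section \<open>Trees of functions from countable ordinals to \<open>\<omega>\<close>\<close>

type_synonym fn = "omega1 \<Rightarrow> nat option"

definition omega_seqs :: "fn set" where
  "omega_seqs = {f. \<exists>\<alpha>. dom f = {..<\<alpha>}}"

definition ht :: "fn \<Rightarrow> omega1" where
  "ht t = (THE \<alpha>. dom t = {..<\<alpha>})"

definition end_ext :: "fn \<Rightarrow> fn \<Rightarrow> bool" where
  "end_ext s t \<longleftrightarrow> s \<subseteq>\<^sub>m t \<and> s \<noteq> t"

definition is_tree :: "fn set \<Rightarrow> bool" where
  "is_tree T \<longleftrightarrow> T \<subseteq> omega_seqs \<and> (\<forall>t\<in>T. \<forall>\<alpha><ht t. t |` {..<\<alpha>} \<in> T)"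

definition level :: "fn set \<Rightarrow> omega1 \<Rightarrow> fn set" where
  "level T \<alpha> = {t \<in> T. ht t = \<alpha>}"

definition below :: "fn set \<Rightarrow> omega1 \<Rightarrow> fn set" where
  "below T \<delta> = (\<Union>\<gamma>\<in>{..<\<delta>}. level T \<gamma>)"

text \<open>
  Every node has a countable ordinal as its height, so a tree has height \<open>\<omega>\<^sub>1\<close> if and only if
  no level is empty.
\<close>

definition omega1_tree :: "fn set \<Rightarrow> bool" where
  "omega1_tree T \<longleftrightarrow> is_tree T \<and> (\<forall>\<alpha>. level T \<alpha> \<noteq> {}) \<and> (\<forall>\<alpha>. countable (level T \<alpha>))"

definition normal_tree :: "fn set \<Rightarrow> bool" where
  "normal_tree T \<longleftrightarrow> (\<forall>s\<in>T. \<forall>\<alpha>. ht s < \<alpha> \<longrightarrow> (\<exists>t\<in>level T \<alpha>. end_ext s t))"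

definition immediate_succs :: "fn set \<Rightarrow> fn \<Rightarrow> fn set" where
  "immediate_succs T s = {t \<in> T. end_ext s t \<and> \<not> (\<exists>u\<in>T. end_ext s u \<and> end_ext u t)}"

definition omega_splitting :: "fn set \<Rightarrow> bool" where
  "omega_splitting T \<longleftrightarrow> (\<forall>s\<in>T. infinite (immediate_succs T s))"

definition comparable :: "fn \<Rightarrow> fn \<Rightarrow> bool" where
  "comparable s t \<longleftrightarrow> s = t \<or> end_ext s t \<or> end_ext t s"

definition tree_chain :: "fn set \<Rightarrow> fn set \<Rightarrow> bool" where
  "tree_chain T C \<longleftrightarrow> C \<subseteq> T \<and> (\<forall>s\<in>C. \<forall>t\<in>C. comparable s t)"

definition tree_antichain :: "fn set \<Rightarrow> fn set \<Rightarrow> bool" where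
  "tree_antichain T A \<longleftrightarrow> A \<subseteq> T \<and> (\<forall>s\<in>A. \<forall>t\<in>A. s \<noteq> t \<longrightarrow> \<not> comparable s t)"

definition souslin :: "fn set \<Rightarrow> bool" where
  "souslin T \<longleftrightarrow> omega1_tree T \<and> (\<forall>C. tree_chain T C \<longrightarrow> countable C)
     \<and> (\<forall>A. tree_antichain T A \<longrightarrow> countable A)"

definition sup_norm :: "fn \<Rightarrow> enat" where
  "sup_norm f = (SUP \<gamma>\<in>dom f. enat (the (f \<gamma>)))"

definition abs_diff :: "fn \<Rightarrow> fn \<Rightarrow> fn" where
  "abs_diff f g = (\<lambda>\<gamma>. if \<gamma> \<in> dom f \<inter> dom g
     then Some (nat \<bar>int (the (f \<gamma>)) - int (the (g \<gamma>))\<bar>) else None)"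

definition linf_tree :: "fn set \<Rightarrow> bool" where
  "linf_tree T \<longleftrightarrow> omega1_tree T \<and> (\<forall>s\<in>T. \<forall>t\<in>T. sup_norm (abs_diff s t) < \<infinity>)"

section \<open>Group topologies and the Tukey order\<close>

definition group_topology :: "('a, 'b) monoid_scheme \<Rightarrow> 'a topology \<Rightarrow> bool" where
  "group_topology G \<tau> \<longleftrightarrow> group G \<and> topspace \<tau> = carrier G
     \<and> continuous_map (prod_topology \<tau> \<tau>) \<tau> (\<lambda>(x, y). x \<otimes>\<^bsub>G\<^esub> y)
     \<and> continuous_map \<tau> \<tau> (\<lambda>x. inv\<^bsub>G\<^esub> x)"

definition open_nbhds :: "'a topology \<Rightarrow> 'a \<Rightarrow> 'a set set" where
  "open_nbhds \<tau> x = {U. openin \<tau> U \<and> x \<in> U}"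

definition open_nbhd_base :: "'a topology \<Rightarrow> 'a \<Rightarrow> 'a set set \<Rightarrow> bool" where
  "open_nbhd_base \<tau> x \<B> \<longleftrightarrow>
     \<B> \<subseteq> open_nbhds \<tau> x \<and> (\<forall>W\<in>open_nbhds \<tau> x. \<exists>U\<in>\<B>. U \<subseteq> W)"

definition bounded_in :: "'a set \<Rightarrow> ('a \<Rightarrow> 'a \<Rightarrow> bool) \<Rightarrow> 'a set \<Rightarrow> bool" where
  "bounded_in D leD X \<longleftrightarrow> (\<exists>d\<in>D. \<forall>x\<in>X. leD x d)"

definition tukey_le ::
  "'a set \<Rightarrow> ('a \<Rightarrow> 'a \<Rightarrow> bool) \<Rightarrow> 'b set \<Rightarrow> ('b \<Rightarrow> 'b \<Rightarrow> bool) \<Rightarrow> bool" where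
  "tukey_le D leD E leE \<longleftrightarrow> (\<exists>f. f \<in> D \<rightarrow> E \<and>
     (\<forall>X\<subseteq>D. \<not> bounded_in D leD X \<longrightarrow> \<not> bounded_in E leE (f ` X)))"

definition tukey_le_group ::
  "'a set \<Rightarrow> ('a \<Rightarrow> 'a \<Rightarrow> bool) \<Rightarrow> ('b, 'c) monoid_scheme \<Rightarrow> 'b topology \<Rightarrow> bool" where
  "tukey_le_group D leD G \<tau> \<longleftrightarrow> tukey_le D leD (open_nbhds \<tau> \<one>\<^bsub>G\<^esub>) (\<supseteq>)"

section \<open>The group \<open>G(\<F>\<^sup>\<infinity>\<^sub>T)\<close>\<close>

definition F_inf :: "fn set \<Rightarrow> nat \<Rightarrow> fn \<Rightarrow> fn set" where
  "F_inf T n t = {s \<in> below T (ht t). sup_norm (abs_diff s t) \<le> enat n}"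

definition U_inf :: "fn set \<Rightarrow> nat \<Rightarrow> fn \<Rightarrow> fn set set" where
  "U_inf T n t = {a \<in> Fpow T. a \<inter> F_inf T n t = {}}"

definition G_inf :: "fn set \<Rightarrow> fn set monoid" where
  "G_inf T = \<lparr>carrier = Fpow T, monoid.mult = (\<lambda>a b. sym_diff a b), one = {}\<rparr>"

text \<open>
  Existence and uniqueness of this topology for \<open>\<ell>\<^sub>\<infinity>\<close>-trees, and an explicit description
  of its open sets, are proved at the end of this theory.
\<close>

definition G_inf_topology :: "fn set \<Rightarrow> fn set topology" where
  "G_inf_topology T = (THE \<tau>. group_topology (G_inf T) \<tau>
     \<and> open_nbhd_base \<tau> \<one>\<^bsub>G_inf T\<^esub> {U_inf T n t | n t. t \<in> T})"

subsection \<open>Well-definedness of the topology\<close>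

lemma ht_eq:
  assumes "dom t = {..<\<alpha>}"
  shows "ht t = \<alpha>"
proof -
  have "\<beta> = \<alpha>" if "{..<\<alpha>} = {..<\<beta>}" for \<beta> :: omega1
    using that by (metis lessThan_iff less_irrefl linorder_neqE)
  then show ?thesis
    unfolding ht_def using assms by (intro the_equality) auto
qed

lemma dom_eq_ht: "t \<in> omega_seqs \<Longrightarrow> dom t = {..<ht t}"
  using ht_eq by (auto simp: omega_seqs_def)

lemma sup_norm_abs_diff_le_iff:
  "sup_norm (abs_diff s t) \<le> enat n \<longleftrightarrow>
     (\<forall>\<gamma>\<in>dom s \<inter> dom t. \<bar>int (the (s \<gamma>)) - int (the (t \<gamma>))\<bar> \<le> int n)"
proof -
  have "dom (abs_diff s t) = dom s \<inter> dom t"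
    by (auto simp: abs_diff_def split: if_splits)
  then show ?thesis
    by (auto simp: sup_norm_def SUP_le_iff abs_diff_def nat_le_iff)
qed

lemma group_G_inf: "group (G_inf T)"
proof (rule groupI)
  fix x assume "x \<in> carrier (G_inf T)"
  then show "\<exists>y\<in>carrier (G_inf T). y \<otimes>\<^bsub>G_inf T\<^esub> x = \<one>\<^bsub>G_inf T\<^esub>"
    by (intro bexI[of _ x]) (auto simp: G_inf_def)
qed (auto simp: G_inf_def Fpow_def)

lemma inv_G_inf: "x \<in> carrier (G_inf T) \<Longrightarrow> inv\<^bsub>G_inf T\<^esub> x = x"
  by (rule group.inv_equality[OF group_G_inf]) (auto simp: G_inf_def)

lemma U_inf_sym_diff: "a \<in> U_inf T n t \<Longrightarrow> b \<in> U_inf T n t \<Longrightarrow> sym_diff a b \<in> U_inf T n t"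
  by (auto simp: U_inf_def Fpow_def)

lemma empty_in_U_inf: "{} \<in> U_inf T n t"
  by (auto simp: U_inf_def Fpow_def)

lemma U_inf_directed:
  assumes T: "linf_tree T" and s: "s \<in> T" and t: "t \<in> T"
  shows "\<exists>k. \<exists>r\<in>T. U_inf T k r \<subseteq> U_inf T m s \<inter> U_inf T n t"
proof -
  have main: "\<exists>k. \<exists>r\<in>T. U_inf T k r \<subseteq> U_inf T m s \<inter> U_inf T n t"
    if st: "s \<in> T" "t \<in> T" and le: "ht s \<le> ht t" for m n s t
  proof -
    have seqs: "T \<subseteq> omega_seqs"
      using T by (auto simp: linf_tree_def omega1_tree_def is_tree_def)
    have "sup_norm (abs_diff s t) < \<infinity>"
      using T st by (auto simp: linf_tree_def)
    then obtain d where "sup_norm (abs_diff s t) \<le> enat d"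
      by (metis less_infinityE order_refl)
    then have d: "\<forall>\<gamma>\<in>dom s \<inter> dom t. \<bar>int (the (s \<gamma>)) - int (the (t \<gamma>))\<bar> \<le> int d"
      by (simp add: sup_norm_abs_diff_le_iff)
    let ?k = "max n (m + d)"
    have "F_inf T m s \<subseteq> F_inf T ?k t"
    proof
      fix u assume "u \<in> F_inf T m s"
      then have u: "u \<in> T" "ht u < ht s"
        and un: "\<forall>\<gamma>\<in>dom u \<inter> dom s. \<bar>int (the (u \<gamma>)) - int (the (s \<gamma>))\<bar> \<le> int m"
        by (auto simp: F_inf_def below_def level_def sup_norm_abs_diff_le_iff)
      have "\<bar>int (the (u \<gamma>)) - int (the (t \<gamma>))\<bar> \<le> int ?k" if "\<gamma> \<in> dom u \<inter> dom t" for \<gamma>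
      proof -
        have "dom u = {..<ht u}" "dom s = {..<ht s}"
          using dom_eq_ht u st seqs by blast+
        then have "\<gamma> \<in> dom s" using that u by auto
        then have "\<bar>int (the (u \<gamma>)) - int (the (s \<gamma>))\<bar> \<le> int m"
          "\<bar>int (the (s \<gamma>)) - int (the (t \<gamma>))\<bar> \<le> int d"
          using un d that by blast+
        then show ?thesis by linarith
      qed
      then show "u \<in> F_inf T ?k t"
        using u le by (auto simp: F_inf_def below_def level_def sup_norm_abs_diff_le_iff)
    qed
    moreover have "F_inf T n t \<subseteq> F_inf T ?k t"
      by (auto simp: F_inf_def elim!: order_trans)
    ultimately have "U_inf T ?k t \<subseteq> U_inf T m s \<inter> U_inf T n t"
      by (auto simp: U_inf_def)
    then show ?thesis using st by blast
  qed
  show ?thesis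
    using main[OF s t] main[OF t s] by (metis Int_commute linear)
qed

definition G_inf_open :: "fn set \<Rightarrow> fn set set \<Rightarrow> bool" where
  "G_inf_open T W \<longleftrightarrow> W \<subseteq> Fpow T \<and>
     (\<forall>a\<in>W. \<exists>n. \<exists>t\<in>T. \<forall>u\<in>U_inf T n t. sym_diff a u \<in> W)"

lemma istopology_G_inf_open:
  assumes T: "linf_tree T"
  shows "istopology (G_inf_open T)"
  unfolding istopology_def
proof (intro conjI allI impI)
  fix V W assume V: "G_inf_open T V" and W: "G_inf_open T W"
  show "G_inf_open T (V \<inter> W)"
    unfolding G_inf_open_def
  proof (intro conjI ballI)
    show "V \<inter> W \<subseteq> Fpow T" using V by (auto simp: G_inf_open_def)
    fix a assume a: "a \<in> V \<inter> W"
    obtain m s where 1: "s \<in> T" "\<forall>u\<in>U_inf T m s. sym_diff a u \<in> V"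
      using V a unfolding G_inf_open_def by blast
    obtain n t where 2: "t \<in> T" "\<forall>u\<in>U_inf T n t. sym_diff a u \<in> W"
      using W a unfolding G_inf_open_def by blast
    obtain k r where "r \<in> T" "U_inf T k r \<subseteq> U_inf T m s \<inter> U_inf T n t"
      using U_inf_directed[OF T] 1 2 by blast
    then show "\<exists>n. \<exists>t\<in>T. \<forall>u\<in>U_inf T n t. sym_diff a u \<in> V \<inter> W"
      using 1 2 by blast
  qed
next
  fix K assume K: "\<forall>W\<in>K. G_inf_open T W"
  show "G_inf_open T (\<Union>K)"
    unfolding G_inf_open_def
  proof (intro conjI ballI)
    show "\<Union>K \<subseteq> Fpow T" using K by (auto simp: G_inf_open_def)
    fix a assume "a \<in> \<Union>K"
    then obtain W where W: "W \<in> K" "a \<in> W" by blast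
    then obtain n t where "t \<in> T" "\<forall>u\<in>U_inf T n t. sym_diff a u \<in> W"
      using K unfolding G_inf_open_def by blast
    then show "\<exists>n. \<exists>t\<in>T. \<forall>u\<in>U_inf T n t. sym_diff a u \<in> \<Union>K"
      using W by blast
  qed
qed

lemma sym_diff_assoc: "sym_diff (sym_diff a b) c = sym_diff a (sym_diff b c)"
  by blast

lemma sym_diff_cancel: "sym_diff a (sym_diff a b) = b"
  by blast

lemma sym_diff_in_Fpow: "a \<in> Fpow T \<Longrightarrow> b \<in> Fpow T \<Longrightarrow> sym_diff a b \<in> Fpow T"
  by (auto simp: Fpow_def)

lemma U_inf_subset: "U_inf T n t \<subseteq> Fpow T"
  by (auto simp: U_inf_def)

lemma G_inf_open_coset:
  assumes "t \<in> T" "a \<in> Fpow T"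
  shows "G_inf_open T ((\<lambda>u. sym_diff a u) ` U_inf T n t)"
  unfolding G_inf_open_def
proof (intro conjI ballI)
  show "(\<lambda>u. sym_diff a u) ` U_inf T n t \<subseteq> Fpow T"
    using assms U_inf_subset sym_diff_in_Fpow by blast
  fix b assume "b \<in> (\<lambda>u. sym_diff a u) ` U_inf T n t"
  then obtain v where v: "v \<in> U_inf T n t" "b = sym_diff a v" by blast
  have "sym_diff b u \<in> (\<lambda>u. sym_diff a u) ` U_inf T n t" if "u \<in> U_inf T n t" for u
    unfolding v(2) sym_diff_assoc by (intro imageI U_inf_sym_diff v that)
  then show "\<exists>n'. \<exists>t'\<in>T. \<forall>u\<in>U_inf T n' t'. sym_diff b u \<in> (\<lambda>u. sym_diff a u) ` U_inf T n t"
    using assms by blast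
qed

lemma G_inf_topology_exists:
  assumes T: "linf_tree T"
  defines "\<tau> \<equiv> topology (G_inf_open T)"
  shows "group_topology (G_inf T) \<tau>
    \<and> open_nbhd_base \<tau> \<one>\<^bsub>G_inf T\<^esub> {U_inf T n t | n t. t \<in> T}"
proof -
  have op: "openin \<tau> W \<longleftrightarrow> G_inf_open T W" for W
    unfolding \<tau>_def by (simp add: topology_inverse'[OF istopology_G_inf_open[OF T]])
  obtain t0 where t0: "t0 \<in> T"
    using T by (force simp: linf_tree_def omega1_tree_def level_def)
  have "G_inf_open T (Fpow T)"
    unfolding G_inf_open_def using t0 U_inf_subset sym_diff_in_Fpow by blast
  then have ts: "topspace \<tau> = Fpow T"
    unfolding topspace_def using op by (auto simp: G_inf_open_def)
  have mult: "continuous_map (prod_topology \<tau> \<tau>) \<tau> (\<lambda>(x, y). sym_diff x y)"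
    unfolding continuous_map_def
  proof (intro conjI allI impI)
    show "(\<lambda>(x, y). sym_diff x y) \<in> topspace (prod_topology \<tau> \<tau>) \<rightarrow> topspace \<tau>"
      using sym_diff_in_Fpow by (auto simp: ts)
    fix W assume W: "openin \<tau> W"
    show "openin (prod_topology \<tau> \<tau>)
      {p \<in> topspace (prod_topology \<tau> \<tau>). (case p of (x, y) \<Rightarrow> sym_diff x y) \<in> W}"
      unfolding openin_prod_topology_alt
    proof (intro allI impI)
      fix x y assume "(x, y) \<in> {p \<in> topspace (prod_topology \<tau> \<tau>).
        (case p of (x, y) \<Rightarrow> sym_diff x y) \<in> W}"
      then have xy: "x \<in> Fpow T" "y \<in> Fpow T" "sym_diff x y \<in> W"
        by (auto simp: ts)
      obtain n t where t: "t \<in> T" "\<forall>u\<in>U_inf T n t. sym_diff (sym_diff x y) u \<in> W"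
        using W xy unfolding op G_inf_open_def by blast
      let ?C = "\<lambda>a. (\<lambda>u. sym_diff a u) ` U_inf T n t"
      have "openin \<tau> (?C x)" "openin \<tau> (?C y)"
        using G_inf_open_coset t xy op by blast+
      moreover have "x \<in> ?C x" "y \<in> ?C y"
        using empty_in_U_inf by (auto intro!: image_eqI[where x = "{}"])
      moreover have "?C x \<times> ?C y \<subseteq> {p \<in> topspace (prod_topology \<tau> \<tau>).
        (case p of (x, y) \<Rightarrow> sym_diff x y) \<in> W}"
      proof
        fix p assume "p \<in> ?C x \<times> ?C y"
        then obtain u v where uv: "u \<in> U_inf T n t" "v \<in> U_inf T n t"
          and p: "p = (sym_diff x u, sym_diff y v)" by blast
        have "sym_diff (sym_diff x u) (sym_diff y v) = sym_diff (sym_diff x y) (sym_diff u v)"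
          by blast
        then have "sym_diff (sym_diff x u) (sym_diff y v) \<in> W"
          using t uv U_inf_sym_diff by metis
        moreover have "sym_diff x u \<in> Fpow T" "sym_diff y v \<in> Fpow T"
          using xy uv U_inf_subset sym_diff_in_Fpow by blast+
        ultimately show "p \<in> {p \<in> topspace (prod_topology \<tau> \<tau>).
          (case p of (x, y) \<Rightarrow> sym_diff x y) \<in> W}"
          by (simp add: ts p)
      qed
      ultimately show "\<exists>U V. openin \<tau> U \<and> openin \<tau> V \<and> x \<in> U \<and> y \<in> V \<and>
         U \<times> V \<subseteq> {p \<in> topspace (prod_topology \<tau> \<tau>). (case p of (x, y) \<Rightarrow> sym_diff x y) \<in> W}"
        by blast
    qed
  qed
  have car: "topspace \<tau> = carrier (G_inf T)"
    by (simp add: ts G_inf_def)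
  then have inv: "continuous_map \<tau> \<tau> (\<lambda>x. inv\<^bsub>G_inf T\<^esub> x)"
    by (intro continuous_map_eq[OF continuous_map_id]) (simp add: inv_G_inf)
  have "(\<lambda>(x, y). x \<otimes>\<^bsub>G_inf T\<^esub> y) = (\<lambda>(x, y). sym_diff x y)"
    by (simp add: G_inf_def)
  with mult have "group_topology (G_inf T) \<tau>"
    unfolding group_topology_def using group_G_inf car inv by presburger
  moreover have U_open: "G_inf_open T (U_inf T n t)" if "t \<in> T" for n t
    using G_inf_open_coset[OF that, of "{}" n] by (simp add: Fpow_def)
  have "open_nbhd_base \<tau> {} {U_inf T n t | n t. t \<in> T}"
    unfolding open_nbhd_base_def open_nbhds_def op
  proof (intro conjI ballI)
    show "{U_inf T n t | n t. t \<in> T} \<subseteq> {U. G_inf_open T U \<and> {} \<in> U}"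
      using U_open empty_in_U_inf by blast
    fix W assume W: "W \<in> {U. G_inf_open T U \<and> {} \<in> U}"
    then obtain n t where "t \<in> T" "\<forall>u\<in>U_inf T n t. sym_diff {} u \<in> W"
      unfolding G_inf_open_def by blast
    then have "U_inf T n t \<subseteq> W" by auto
    then show "\<exists>U\<in>{U_inf T n t | n t. t \<in> T}. U \<subseteq> W"
      using \<open>t \<in> T\<close> by blast
  qed
  moreover have "\<one>\<^bsub>G_inf T\<^esub> = {}" by (simp add: G_inf_def)
  ultimately show ?thesis by simp
qed

lemma G_inf_topology_unique:
  assumes gt: "group_topology (G_inf T) \<tau>"
    and base: "open_nbhd_base \<tau> \<one>\<^bsub>G_inf T\<^esub> {U_inf T n t | n t. t \<in> T}"
  shows "openin \<tau> W \<longleftrightarrow> G_inf_open T W"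
proof -
  have ts: "topspace \<tau> = Fpow T"
    and mult: "continuous_map (prod_topology \<tau> \<tau>) \<tau> (\<lambda>(x, y). sym_diff x y)"
    using gt by (auto simp: group_topology_def G_inf_def)
  have U_open: "openin \<tau> (U_inf T n t)" if "t \<in> T" for n t
    using base that by (auto simp: open_nbhd_base_def open_nbhds_def)
  have U_base: "\<exists>n. \<exists>t\<in>T. U_inf T n t \<subseteq> W" if "openin \<tau> W" "{} \<in> W" for W
    using base that by (fastforce simp: open_nbhd_base_def open_nbhds_def G_inf_def)
  have shift: "continuous_map \<tau> \<tau> (\<lambda>y. sym_diff a y)" if "a \<in> Fpow T" for a
  proof -
    have "continuous_map \<tau> (prod_topology \<tau> \<tau>) (\<lambda>y. (a, y))"
      using that by (simp add: continuous_map_pairwise o_def ts)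
    from continuous_map_compose[OF this mult] show ?thesis
      by (simp add: o_def)
  qed
  have shift_open: "openin \<tau> {y \<in> Fpow T. sym_diff a y \<in> V}"
    if "a \<in> Fpow T" "openin \<tau> V" for a V
    using shift[OF that(1)] that(2) by (auto simp: continuous_map_def ts)
  show ?thesis
  proof
    assume W: "openin \<tau> W"
    then have sub: "W \<subseteq> Fpow T" using openin_subset ts by blast
    have "\<exists>n. \<exists>t\<in>T. \<forall>u\<in>U_inf T n t. sym_diff a u \<in> W" if "a \<in> W" for a
    proof -
      have 0: "{} \<in> {y \<in> Fpow T. sym_diff a y \<in> W}"
        using that by (auto simp: Fpow_def)
      have "openin \<tau> {y \<in> Fpow T. sym_diff a y \<in> W}"
        using shift_open W sub that by blast
      from U_base[OF this 0] show ?thesis by blast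
    qed
    with sub show "G_inf_open T W" by (simp add: G_inf_open_def)
  next
    assume W: "G_inf_open T W"
    show "openin \<tau> W"
    proof (subst openin_subopen, intro ballI)
      fix a assume a: "a \<in> W"
      then obtain n t where t: "t \<in> T" "\<forall>u\<in>U_inf T n t. sym_diff a u \<in> W"
        using W unfolding G_inf_open_def by blast
      have aF: "a \<in> Fpow T" using W a by (auto simp: G_inf_open_def)
      let ?V = "{y \<in> Fpow T. sym_diff a y \<in> U_inf T n t}"
      have "openin \<tau> ?V" by (rule shift_open[OF aF U_open[OF t(1)]])
      moreover have "a \<in> ?V" using aF empty_in_U_inf by simp
      moreover have "?V \<subseteq> W"
        using t(2) by (metis (no_types, lifting) mem_Collect_eq subsetI sym_diff_cancel)
      ultimately show "\<exists>V. openin \<tau> V \<and> a \<in> V \<and> V \<subseteq> W" by blast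
    qed
  qed
qed

theorem G_inf_topology_ex1:
  assumes "linf_tree T"
  shows "\<exists>!\<tau>. group_topology (G_inf T) \<tau>
    \<and> open_nbhd_base \<tau> \<one>\<^bsub>G_inf T\<^esub> {U_inf T n t | n t. t \<in> T}"
proof (rule ex1I)
  show "group_topology (G_inf T) (topology (G_inf_open T))
    \<and> open_nbhd_base (topology (G_inf_open T)) \<one>\<^bsub>G_inf T\<^esub> {U_inf T n t | n t. t \<in> T}"
    by (rule G_inf_topology_exists[OF assms])
  fix \<tau> assume "group_topology (G_inf T) \<tau>
    \<and> open_nbhd_base \<tau> \<one>\<^bsub>G_inf T\<^esub> {U_inf T n t | n t. t \<in> T}"
  then have "openin \<tau> W = G_inf_open T W" for W
    using G_inf_topology_unique by blast
  then show "\<tau> = topology (G_inf_open T)"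
    by (simp add: topology_eq topology_inverse'[OF istopology_G_inf_open[OF assms]])
qed

corollary openin_G_inf_topology:
  assumes "linf_tree T"
  shows "openin (G_inf_topology T) W \<longleftrightarrow> G_inf_open T W"
  using theI'[OF G_inf_topology_ex1[OF assms]] G_inf_topology_unique
  unfolding G_inf_topology_def by blast

end

theory Submission
  imports Defs
begin

text \<open>
  A Tukey map yields neighbourhoods \<open>U_inf T (n \<alpha>) (t \<alpha>)\<close>, indexed by \<open>\<alpha> < \<omega>\<^sub>1\<close>, such that no
  neighbourhood of the identity lies in infinitely many of them. Passing to an uncountable index
  set, \<open>n \<alpha>\<close> is a constant \<open>n\<close>. If some node \<open>r\<close> extends infinitely many of the \<open>t \<alpha>\<close>, then
  \<open>U_inf T n r\<close> contradicts this. Such a node exists in a Souslin tree: an uncountable \<open>A \<subseteq> T\<close> is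
  dense above some \<open>s\<close>, and then the countability of maximal antichains of \<open>A\<close> above \<open>s\<close> gives
  \<open>\<gamma>\<^sub>0 < \<gamma>\<^sub>1 < \<dots>\<close> such that every node above \<open>s\<close> of height at least \<open>\<gamma>\<^sub>k\<^sub>+\<^sub>1\<close> extends an element
  of \<open>A\<close> with height between \<open>\<gamma>\<^sub>k\<close> and \<open>\<gamma>\<^sub>k\<^sub>+\<^sub>1\<close>. Any node above \<open>s\<close> whose height bounds all
  \<open>\<gamma>\<^sub>k\<close> is as required.
\<close>

section \<open>Countable ordinals, heights and comparability\<close>

lemma countable_bounded_omega1:
  fixes C :: "omega1 set"
  assumes "countable C"
  shows "\<exists>\<gamma>. \<forall>x\<in>C. x < \<gamma>"
proof -
  have "countable (\<Union>x\<in>C. insert x {..<x})"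
    using assms countable_lessThan_omega1 by blast
  then obtain \<gamma> where "\<gamma> \<notin> (\<Union>x\<in>C. insert x {..<x})"
    using uncountable_UNIV_omega1 by (metis UNIV_eq_I)
  then have "x < \<gamma>" if "x \<in> C" for x
    using that by (metis UN_I insertCI lessThan_iff linorder_neqE)
  then show ?thesis by blast
qed

lemma comparable_iff: "comparable s t \<longleftrightarrow> s \<subseteq>\<^sub>m t \<or> t \<subseteq>\<^sub>m s"
  by (auto simp: comparable_def end_ext_def)

lemma ht_mono:
  assumes "s \<in> omega_seqs" "t \<in> omega_seqs" "s \<subseteq>\<^sub>m t"
  shows "ht s \<le> ht t"
proof -
  have "{..<ht s} \<subseteq> {..<ht t}"
    using map_le_implies_dom_le[OF assms(3)] assms(1,2) by (simp add: dom_eq_ht)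
  then show ?thesis by (metis lessThan_iff less_irrefl not_less subsetD)
qed

text \<open>Both nodes are restrictions of \<open>u\<close>, so they agree wherever both are
  defined, and their heights decide which domain is larger.\<close>

lemma map_le_common_extension:
  assumes "s \<in> omega_seqs" "t \<in> omega_seqs" "s \<subseteq>\<^sub>m u" "t \<subseteq>\<^sub>m u" "ht s \<le> ht t"
  shows "s \<subseteq>\<^sub>m t"
proof -
  have "dom s \<subseteq> dom t" using assms by (auto simp: dom_eq_ht)
  with assms(3,4) show ?thesis by (metis map_le_def subsetD)
qed

lemma comparable_imp_map_le:
  assumes "s \<in> omega_seqs" "t \<in> omega_seqs" "comparable s t" "ht s \<le> ht t"
  shows "s \<subseteq>\<^sub>m t"
  \<comment> \<open>If \<open>t\<close> is below \<open>s\<close>, then \<open>s\<close> serves as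
    the common extension of both nodes.\<close>
  using assms map_le_common_extension[of s t s] by (auto simp: comparable_iff)

section \<open>Antichains and heights in Souslin trees\<close>

lemma maximal_antichain_exists:
  assumes "N \<subseteq> T"
  obtains M where "M \<subseteq> N" "tree_antichain T M" "\<And>u. u \<in> N \<Longrightarrow> \<exists>m\<in>M. comparable u m"
proof -
  let ?\<A> = "{M. M \<subseteq> N \<and> tree_antichain T M}"
  have "\<exists>M\<in>?\<A>. \<forall>X\<in>?\<A>. M \<subseteq> X \<longrightarrow> X = M"
  proof (rule subset_Zorn_nonempty)
    show "?\<A> \<noteq> {}" by (auto simp: tree_antichain_def)
    fix \<C> assume "\<C> \<noteq> {}" and C: "subset.chain ?\<A> \<C>"
    \<comment> \<open>Of two members of a chain one contains the other, so two nodes of the union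
      already lie in a common antichain.\<close>
    have "\<not> comparable s t" if "s \<in> X" "t \<in> Y" "X \<in> \<C>" "Y \<in> \<C>" "s \<noteq> t" for s t X Y
    proof -
      have "X \<subseteq> Y \<or> Y \<subseteq> X" using C that(3,4) unfolding subset_chain_def by blast
      moreover have "tree_antichain T X" "tree_antichain T Y"
        using C that(3,4) by (auto simp: subset.chain_def)
      ultimately show ?thesis using that by (auto simp: tree_antichain_def)
    qed
    moreover have "\<Union>\<C> \<subseteq> N" using C by (auto simp: subset.chain_def)
    ultimately show "\<Union>\<C> \<in> ?\<A>" using assms unfolding tree_antichain_def by blast
  qed
  then obtain M where M: "M \<subseteq> N" "tree_antichain T M"
    and max: "\<forall>X\<in>?\<A>. M \<subseteq> X \<longrightarrow> X = M" by auto
  have "\<exists>m\<in>M. comparable u m" if u: "u \<in> N" for u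
  proof (rule ccontr)
    assume *: "\<not> (\<exists>m\<in>M. comparable u m)"
    then have "tree_antichain T (insert u M)"
      using M u assms unfolding tree_antichain_def comparable_iff by auto
    then have "u \<in> M" using max M(1) u by blast
    with * show False by (auto simp: comparable_def)
  qed
  with M show thesis by (rule that)
qed

text \<open>Antichains are countable, so the heights in a maximal one are bounded. This lets a
  bounded part of the tree control all of \<open>N\<close>.\<close>

lemma souslin_maximal_antichain:
  assumes "souslin T" "N \<subseteq> T"
  obtains M \<gamma> where "M \<subseteq> N" "\<And>m. m \<in> M \<Longrightarrow> ht m < \<gamma>"
    "\<And>u. u \<in> N \<Longrightarrow> \<exists>m\<in>M. comparable u m"
proof -
  obtain M where M: "M \<subseteq> N" "tree_antichain T M" "\<And>u. u \<in> N \<Longrightarrow> \<exists>m\<in>M. comparable u m"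
    using maximal_antichain_exists[OF assms(2)] by blast
  have "countable (ht ` M)" using assms(1) M(2) by (simp add: souslin_def)
  then obtain \<gamma> where "\<forall>x\<in>ht ` M. x < \<gamma>" using countable_bounded_omega1 by blast
  with M show thesis by (intro that[of M \<gamma>]) auto
qed

lemma uncountable_unbounded_ht:
  assumes "omega1_tree T" "A \<subseteq> T" "uncountable A"
  shows "\<exists>a\<in>A. \<gamma> < ht a"
proof (rule ccontr)
  assume "\<not> (\<exists>a\<in>A. \<gamma> < ht a)"
  then have "A \<subseteq> (\<Union>\<beta>\<in>insert \<gamma> {..<\<gamma>}. level T \<beta>)"
    using assms(2) by (force simp: level_def not_less le_less)
  moreover have "countable (\<Union>\<beta>\<in>insert \<gamma> {..<\<gamma>}. level T \<beta>)"
    using assms(1) countable_lessThan_omega1 by (intro countable_UN) (auto simp: omega1_tree_def)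
  ultimately show False using assms(3) countable_subset by blast
qed

lemma omega1_tree_subset_omega_seqs: "omega1_tree T \<Longrightarrow> T \<subseteq> omega_seqs"
  by (simp add: omega1_tree_def is_tree_def)

lemma normal_tree_extend:
  assumes "normal_tree T" "s \<in> T"
  obtains t where "t \<in> T" "s \<subseteq>\<^sub>m t" "\<gamma> \<le> ht t"
proof (cases "ht s < \<gamma>")
  case True
  then obtain t where "t \<in> level T \<gamma>" "end_ext s t"
    using assms unfolding normal_tree_def by blast
  then show thesis by (intro that[of t]) (auto simp: level_def end_ext_def)
next
  case False
  then show thesis using assms by (intro that[of s]) auto
qed

section \<open>Nodes above infinitely many elements of an uncountable set\<close>

text \<open>Let \<open>M\<close> be a maximal antichain of nodes without extension in
  \<open>A\<close>. The witness is an element \<open>a\<close> of \<open>A\<close> higher than all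
  of \<open>M\<close>: a node above \<open>a\<close> without extension in \<open>A\<close> would be
  comparable to some \<open>m\<close> in \<open>M\<close>. Then \<open>m\<close> lies below
  \<open>a\<close>, which is an extension of \<open>m\<close> in \<open>A\<close>.\<close>

lemma souslin_dense_above:
  assumes T: "souslin T" and A: "A \<subseteq> T" "uncountable A"
  obtains s where "s \<in> T" "\<And>u. u \<in> T \<Longrightarrow> s \<subseteq>\<^sub>m u \<Longrightarrow> \<exists>a\<in>A. u \<subseteq>\<^sub>m a"
proof -
  have tree: "omega1_tree T" using T by (simp add: souslin_def)
  have seqs: "x \<in> omega_seqs" if "x \<in> T" for x
    using omega1_tree_subset_omega_seqs[OF tree] that by blast
  define N where "N = {u \<in> T. \<not> (\<exists>a\<in>A. u \<subseteq>\<^sub>m a)}"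
  have NT: "N \<subseteq> T" by (auto simp: N_def)
  obtain M \<gamma> where M: "M \<subseteq> N" "\<And>m. m \<in> M \<Longrightarrow> ht m < \<gamma>"
      "\<And>u. u \<in> N \<Longrightarrow> \<exists>m\<in>M. comparable u m"
    using souslin_maximal_antichain[OF T NT] by blast
  obtain a where a: "a \<in> A" "\<gamma> < ht a"
    using uncountable_unbounded_ht[OF tree A] by blast
  have aT: "a \<in> T" using a A by blast
  have "\<exists>a\<in>A. u \<subseteq>\<^sub>m a" if u: "u \<in> T" "a \<subseteq>\<^sub>m u" for u
  proof (rule ccontr)
    assume "\<not> (\<exists>a\<in>A. u \<subseteq>\<^sub>m a)"
    then have "u \<in> N" using u by (simp add: N_def)
    then obtain m where m: "m \<in> M" "comparable u m" using M(3) by blast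
    have mN: "m \<in> N" "m \<in> T" using m M(1) NT by auto
    have "ht m \<le> ht a" using M(2)[OF m(1)] a(2) by simp
    moreover have "ht a \<le> ht u" using ht_mono seqs aT u by blast
    ultimately have "m \<subseteq>\<^sub>m u"
      using m(2) comparable_imp_map_le[of m u] seqs mN u by (auto simp: comparable_iff)
    then have "m \<subseteq>\<^sub>m a"
      using map_le_common_extension seqs mN aT u \<open>ht m \<le> ht a\<close> by blast
    with mN a(1) show False by (auto simp: N_def)
  qed
  with aT show thesis by (rule that)
qed

text \<open>The ordinal \<open>\<gamma>'\<close> bounds the heights in a maximal antichain
  \<open>M\<close> of \<open>D\<close>. By density some \<open>a\<close> in \<open>D\<close> lies
  above \<open>t\<close>, and it is comparable to some \<open>m\<close> in \<open>M\<close>. As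
  \<open>m\<close> is lower than \<open>t\<close> and both are below \<open>a\<close>,
  \<open>m\<close> is below \<open>t\<close>.\<close>

lemma souslin_dense_reflects:
  assumes T: "souslin T" "normal_tree T" and A: "A \<subseteq> T"
    and dense: "\<And>u. u \<in> T \<Longrightarrow> s \<subseteq>\<^sub>m u \<Longrightarrow> \<exists>a\<in>A. u \<subseteq>\<^sub>m a"
  shows "\<exists>\<gamma>'. \<forall>t\<in>T. s \<subseteq>\<^sub>m t \<longrightarrow> \<gamma>' \<le> ht t \<longrightarrow> (\<exists>a\<in>A. a \<subseteq>\<^sub>m t \<and> \<gamma> \<le> ht a \<and> ht a < \<gamma>')"
proof -
  have seqs: "x \<in> omega_seqs" if "x \<in> T" for x
    using omega1_tree_subset_omega_seqs T(1) that by (auto simp: souslin_def)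
  define D where "D = {a \<in> A. s \<subseteq>\<^sub>m a \<and> \<gamma> \<le> ht a}"
  have DT: "D \<subseteq> T" using A by (auto simp: D_def)
  obtain M \<gamma>' where M: "M \<subseteq> D" "\<And>m. m \<in> M \<Longrightarrow> ht m < \<gamma>'"
      "\<And>u. u \<in> D \<Longrightarrow> \<exists>m\<in>M. comparable u m"
    using souslin_maximal_antichain[OF T(1) DT] by blast
  have "\<exists>a\<in>A. a \<subseteq>\<^sub>m t \<and> \<gamma> \<le> ht a \<and> ht a < \<gamma>'"
    if t: "t \<in> T" "s \<subseteq>\<^sub>m t" "\<gamma>' \<le> ht t" for t
  proof -
    \<comment> \<open>Climbing to height \<gamma> before entering \<open>A\<close> ensures that the
      element of \<open>A\<close> found lies in \<open>D\<close>.\<close>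
    obtain u where u: "u \<in> T" "t \<subseteq>\<^sub>m u" "\<gamma> \<le> ht u"
      using normal_tree_extend[OF T(2) t(1)] by blast
    then obtain a where a: "a \<in> A" "u \<subseteq>\<^sub>m a" using dense t map_le_trans by blast
    have aT: "a \<in> T" using a A by blast
    have ta: "t \<subseteq>\<^sub>m a" using u a map_le_trans by blast
    have "\<gamma> \<le> ht a" using ht_mono[OF seqs seqs a(2)] u aT by simp
    then have "a \<in> D" using a(1) map_le_trans[OF t(2) ta] by (simp add: D_def)
    then obtain m where m: "m \<in> M" "comparable a m" using M(3) by blast
    have mD: "m \<in> D" "m \<in> T" using m M(1) DT by auto
    have mt: "ht m \<le> ht t" using M(2)[OF m(1)] t(3) by simp
    moreover have "ht t \<le> ht a" using ht_mono seqs t aT ta by blast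
    ultimately have "m \<subseteq>\<^sub>m a"
      using m(2) comparable_imp_map_le[of m a] seqs mD aT by (auto simp: comparable_iff)
    then have "m \<subseteq>\<^sub>m t" using map_le_common_extension seqs mD t ta mt by blast
    then show ?thesis using mD M(2)[OF m(1)] by (auto simp: D_def)
  qed
  then show ?thesis by blast
qed

lemma souslin_node_above_infinitely_many:
  assumes T: "souslin T" "normal_tree T" and A: "A \<subseteq> T" "uncountable A"
  obtains r where "r \<in> T" "infinite {a \<in> A. a \<subseteq>\<^sub>m r}"
proof -
  obtain s where s: "s \<in> T" and dense: "\<And>u. u \<in> T \<Longrightarrow> s \<subseteq>\<^sub>m u \<Longrightarrow> \<exists>a\<in>A. u \<subseteq>\<^sub>m a"
    using souslin_dense_above[OF T(1) A] by blast
  obtain g where g: "\<And>\<gamma> t. t \<in> T \<Longrightarrow> s \<subseteq>\<^sub>m t \<Longrightarrow> g \<gamma> \<le> ht t \<Longrightarrow>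
      \<exists>a\<in>A. a \<subseteq>\<^sub>m t \<and> \<gamma> \<le> ht a \<and> ht a < g \<gamma>"
    using souslin_dense_reflects[OF T A(1) dense] by metis
  \<comment> \<open>Iterating \<open>g\<close> gives consecutive bands of heights from
    \<open>c k\<close> up to but excluding \<open>c (Suc k)\<close>. One element of \<open>A\<close>
    below \<open>r\<close> is taken from each band, so these elements are distinct. The starting
    height is arbitrary.\<close>
  define c where "c k = (g ^^ k) (ht s)" for k
  have "countable (range c)" by simp
  then obtain \<delta> where \<delta>: "\<forall>x\<in>range c. x < \<delta>"
    using countable_bounded_omega1 by metis
  obtain r where r: "r \<in> T" "s \<subseteq>\<^sub>m r" "\<delta> \<le> ht r"
    using normal_tree_extend[OF T(2) s] by blast
  have "\<exists>a\<in>A. a \<subseteq>\<^sub>m r \<and> c k \<le> ht a \<and> ht a < c (Suc k)" for k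
  proof -
    have "c (Suc k) \<le> ht r" using \<delta> r(3) by (meson less_le_trans less_imp_le rangeI)
    then show ?thesis using g[OF r(1,2), of "c k"] by (simp add: c_def)
  qed
  then obtain a where a: "\<And>k. a k \<in> A" "\<And>k. a k \<subseteq>\<^sub>m r"
      "\<And>k. c k \<le> ht (a k)" "\<And>k. ht (a k) < c (Suc k)"
    by metis
  have "ht (a k) < ht (a (Suc k))" for k
    using a(4)[of k] a(3)[of "Suc k"] by simp
  then have "strict_mono (\<lambda>k. ht (a k))" by (rule strict_mono_Suc_iff[THEN iffD2, rule_format])
  then have "inj a" using strict_mono_eq by (fastforce intro: injI)
  then have "infinite (range a)" by (simp add: finite_image_iff)
  moreover have "range a \<subseteq> {a \<in> A. a \<subseteq>\<^sub>m r}" using a by auto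
  ultimately have "infinite {a \<in> A. a \<subseteq>\<^sub>m r}" using finite_subset by blast
  with r(1) show thesis by (rule that)
qed

section \<open>Neighbourhoods of the identity and the Tukey map\<close>

lemma U_inf_antimono:
  assumes "s \<in> omega_seqs" "t \<in> omega_seqs" "T \<subseteq> omega_seqs" "s \<subseteq>\<^sub>m t"
  shows "U_inf T n t \<subseteq> U_inf T n s"
proof -
  have "F_inf T n s \<subseteq> F_inf T n t"
  proof
    fix u assume "u \<in> F_inf T n s"
    then have u: "u \<in> T" "ht u < ht s" "sup_norm (abs_diff u s) \<le> enat n"
      by (auto simp: F_inf_def below_def level_def)
    then have "dom u \<subseteq> dom s" using assms by (auto simp: dom_eq_ht subset_iff)
    moreover have "dom s \<subseteq> dom t" using assms(4) by (rule map_le_implies_dom_le)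
    ultimately have "dom u \<inter> dom t = dom u \<inter> dom s" by blast
    moreover have "t \<gamma> = s \<gamma>" if "\<gamma> \<in> dom s" for \<gamma>
      using assms(4) that by (simp add: map_le_def)
    \<comment> \<open>The domain of \<open>u\<close> lies inside that of \<open>s\<close>, where
      \<open>s\<close> and \<open>t\<close> agree, so \<open>u\<close> has the same difference from
      both.\<close>
    ultimately have "abs_diff u t = abs_diff u s"
      unfolding abs_diff_def by (metis IntD2)
    then show "u \<in> F_inf T n t"
      using u ht_mono[OF assms(1,2,4)] by (auto simp: F_inf_def below_def level_def)
  qed
  then show ?thesis by (auto simp: U_inf_def)
qed

lemma U_inf_in_infinitely_many:
  fixes n :: "'i \<Rightarrow> nat"
  assumes T: "souslin T" "normal_tree T"
    and I: "uncountable (UNIV :: 'i set)" and t: "\<And>i. t i \<in> T"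
  shows "\<exists>m. \<exists>r\<in>T. \<exists>J. infinite J \<and> (\<forall>i\<in>J. U_inf T m r \<subseteq> U_inf T (n i) (t i))"
proof -
  have seqs: "T \<subseteq> omega_seqs"
    using omega1_tree_subset_omega_seqs T(1) by (auto simp: souslin_def)
  have "(UNIV :: 'i set) = (\<Union>m. {i. n i = m})" by auto
  then obtain m where m: "uncountable {i. n i = m}"
    using I by (metis countable_UN uncountable_def countableI_type)
  let ?I = "{i. n i = m}"
  show ?thesis
  \<comment> \<open>The map \<open>t\<close> need not be injective. If it takes only countably many
    values on \<open>?I\<close>, one value \<open>r\<close> is taken uncountably often; otherwise
    its image is an uncountable set of nodes.\<close>
  proof (cases "countable (t ` ?I)")
    case True
    have "\<exists>r\<in>t ` ?I. uncountable {i \<in> ?I. t i = r}"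
    proof (rule ccontr)
      assume "\<not> ?thesis"
      then have "countable (\<Union>r\<in>t ` ?I. {i \<in> ?I. t i = r})"
        using True by (intro countable_UN) auto
      moreover have "?I \<subseteq> (\<Union>r\<in>t ` ?I. {i \<in> ?I. t i = r})" by auto
      ultimately show False using m countable_subset by blast
    qed
    then obtain r where r: "r \<in> t ` ?I" "uncountable {i \<in> ?I. t i = r}" ..
    then have "infinite {i \<in> ?I. t i = r}" using countable_finite by blast
    moreover have "r \<in> T" using r t by blast
    ultimately show ?thesis
      by (intro exI[of _ m] bexI[of _ r] exI[of _ "{i \<in> ?I. t i = r}"]) auto
  next
    case False
    have "t ` ?I \<subseteq> T" using t by blast
    then obtain r where r: "r \<in> T" "infinite {a \<in> t ` ?I. a \<subseteq>\<^sub>m r}"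
      using souslin_node_above_infinitely_many[OF T _ False] by blast
    have "{a \<in> t ` ?I. a \<subseteq>\<^sub>m r} = t ` {i \<in> ?I. t i \<subseteq>\<^sub>m r}" by auto
    \<comment> \<open>A finite index set would have a finite image.\<close>
    then have "infinite {i \<in> ?I. t i \<subseteq>\<^sub>m r}" using r(2) by (auto dest: finite_imageI[where h = t])
    moreover have "U_inf T m r \<subseteq> U_inf T (n i) (t i)" if "i \<in> {i \<in> ?I. t i \<subseteq>\<^sub>m r}" for i
      using that U_inf_antimono[of "t i" r T m] seqs r(1) t by auto
    ultimately show ?thesis using r(1) by blast
  qed
qed

theorem theorem6p12:
  fixes T :: "fn set"
  assumes "linf_tree T" and "normal_tree T" and "omega_splitting T" and "souslin T"
  shows "\<not> tukey_le_group (Fpow (UNIV :: omega1 set)) (\<subseteq>) (G_inf T) (G_inf_topology T)"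
proof
  let ?N = "open_nbhds (G_inf_topology T) \<one>\<^bsub>G_inf T\<^esub>"
  assume "tukey_le_group (Fpow (UNIV :: omega1 set)) (\<subseteq>) (G_inf T) (G_inf_topology T)"
  then obtain f where f: "f \<in> Fpow (UNIV :: omega1 set) \<rightarrow> ?N"
    and unb: "\<And>X. X \<subseteq> Fpow UNIV \<Longrightarrow> \<not> bounded_in (Fpow UNIV) (\<subseteq>) X \<Longrightarrow>
      \<not> bounded_in ?N (\<supseteq>) (f ` X)"
    unfolding tukey_le_group_def tukey_le_def by blast
  have base: "open_nbhd_base (G_inf_topology T) \<one>\<^bsub>G_inf T\<^esub> {U_inf T n t | n t. t \<in> T}"
    using theI'[OF G_inf_topology_ex1[OF assms(1)]] by (simp add: G_inf_topology_def)
  \<comment> \<open>Singletons suffice: infinitely many of them are unbounded, since an upper bound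
    would be a finite set containing infinitely many ordinals.\<close>
  have "\<exists>n t. t \<in> T \<and> U_inf T n t \<subseteq> f {\<alpha>}" for \<alpha>
  proof -
    have "f {\<alpha>} \<in> ?N" using f by (auto simp: Fpow_def)
    then show ?thesis using base unfolding open_nbhd_base_def by blast
  qed
  then obtain n t where nt: "\<And>\<alpha>. t \<alpha> \<in> T" "\<And>\<alpha>. U_inf T (n \<alpha>) (t \<alpha>) \<subseteq> f {\<alpha>}"
    by metis
  obtain m r J where r: "r \<in> T" and J: "infinite J"
    and sub: "\<forall>\<alpha>\<in>J. U_inf T m r \<subseteq> U_inf T (n \<alpha>) (t \<alpha>)"
    using U_inf_in_infinitely_many[of T t n, OF assms(4,2) uncountable_UNIV_omega1 nt(1)] by auto
  let ?X = "(\<lambda>\<alpha>. {\<alpha>}) ` J"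
  have "\<not> bounded_in (Fpow UNIV) (\<subseteq>) ?X"
  proof
    assume "bounded_in (Fpow UNIV) (\<subseteq>) ?X"
    then obtain d where "finite d" "J \<subseteq> d" by (auto simp: bounded_in_def Fpow_def)
    with J show False using finite_subset by blast
  qed
  moreover have "?X \<subseteq> Fpow UNIV" by (auto simp: Fpow_def)
  ultimately have "\<not> bounded_in ?N (\<supseteq>) (f ` ?X)" using unb by blast
  \<comment> \<open>Under reverse inclusion this neighbourhood is an upper bound of the image of
    \<open>?X\<close>.\<close>
  moreover have "U_inf T m r \<in> ?N" using base r by (auto simp: open_nbhd_base_def)
  moreover have "U_inf T m r \<subseteq> f {\<alpha>}" if "\<alpha> \<in> J" for \<alpha> using sub that nt(2) by blast
  ultimately show False unfolding bounded_in_def by blast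
qed

end
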